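(* Let $n$ and $m$ be integers with $0\le m<n-1$, let $G$ be a graph of order $n^2-m$, and let $\Delta$ be the maximum degree of a vertex of $G$. If $\Delta\ge n^2-n$, then $N(G,n)\le 1$. Otherwise \[ N(G,n)\le \left\lfloor\frac{n^2-m-\Delta-1}{n-m-1}\right\rfloor. \]
   Context: All graphs are finite simple graphs. An $n$-coloring of a graph $G$ is a proper vertex coloring using at most $n$ colors (adjacent vertices receive distinct colors). Two colorings $C_1,C_2$ of $G$ are orthogonal if whenever two distinct vertices share a color in $C_1$, they have distinct colors in $C_2$. A set of pairwise orthogonal $n$-colorings is called a set of mutually orthogonal $n$-colorings, and $N(G,n)$ denotes the maximum size of a set of mutually orthogonal $n$-colorings of $G$. *)

theory Defs
  imports Complex_Main "HOL-Library.FuncSet" "Graph_Theory.Digraph"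
begin

text \<open>
  Finite simple graphs are the locale \<^locale>\<open>graph\<close>: finite symmetric digraphs without loops
  and parallel arcs, where each edge is represented by its two opposite arcs. Hence the degree of
  a vertex is its \<^const>\<open>out_degree\<close>.
\<close>

definition max_degree :: "('a, 'b) pre_digraph \<Rightarrow> nat" where
  "max_degree G = Max (out_degree G ` verts G)"

text \<open>
  Colors are the numbers below \<open>n\<close>, not all of which need be used. Colorings are
  extensional functions, so that two colorings that agree on all vertices are equal.
\<close>

definition colorings :: "('a, 'b) pre_digraph \<Rightarrow> nat \<Rightarrow> ('a \<Rightarrow> nat) set" where
  "colorings G n = {C \<in> verts G \<rightarrow>\<^sub>E {..<n}. \<forall>u v. u \<rightarrow>\<^bsub>G\<^esub> v \<longrightarrow> C u \<noteq> C v}"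

definition orthogonal_colorings :: "('a, 'b) pre_digraph \<Rightarrow> ('a \<Rightarrow> nat) \<Rightarrow> ('a \<Rightarrow> nat) \<Rightarrow> bool" where
  "orthogonal_colorings G C1 C2 \<longleftrightarrow>
     (\<forall>u \<in> verts G. \<forall>v \<in> verts G. u \<noteq> v \<and> C1 u = C1 v \<longrightarrow> C2 u \<noteq> C2 v)"

definition mutually_orthogonal :: "('a, 'b) pre_digraph \<Rightarrow> nat \<Rightarrow> ('a \<Rightarrow> nat) set \<Rightarrow> bool" where
  "mutually_orthogonal G n S \<longleftrightarrow> S \<subseteq> colorings G n \<and> pairwise (orthogonal_colorings G) S"

definition max_orthogonal :: "('a, 'b) pre_digraph \<Rightarrow> nat \<Rightarrow> nat" where
  "max_orthogonal G n = Max {card S | S. mutually_orthogonal G n S}"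

text \<open>The maximum is taken over a finite nonempty set:\<close>

lemma finite_colorings:
  assumes "graph G"
  shows "finite (colorings G n)"
proof -
  interpret graph G by fact
  have "finite (verts G \<rightarrow>\<^sub>E {..<n})"
    by (intro finite_PiE) auto
  then show ?thesis
    unfolding colorings_def by (rule rev_finite_subset) auto
qed

lemma finite_mutually_orthogonal:
  assumes "graph G"
  shows "finite {S. mutually_orthogonal G n S}"
  using finite_subset[of _ "Pow (colorings G n)"] finite_colorings[OF assms, of n]
  by (auto simp: mutually_orthogonal_def)

lemma mutually_orthogonal_empty: "mutually_orthogonal G n {}"
  by (simp add: mutually_orthogonal_def)

lemma max_orthogonal_le_iff:
  assumes "graph G"
  shows "max_orthogonal G n \<le> k \<longleftrightarrow> (\<forall>S. mutually_orthogonal G n S \<longrightarrow> card S \<le> k)"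
proof -
  have "finite {card S | S. mutually_orthogonal G n S}"
    using finite_mutually_orthogonal[OF assms, of n] by simp
  then show ?thesis
    unfolding max_orthogonal_def using mutually_orthogonal_empty[of G n]
    by (subst Max_le_iff) blast+
qed

end

theory Submission
  imports Defs
begin

text \<open>
  If \<open>C\<close> has an orthogonal mate, then each color class of \<open>C\<close> has at most \<open>n\<close> vertices, because the
  mate is injective on it; as there are only \<open>n\<close> classes, each has at least
  \<open>n^2 - m - (n - 1) n = n - m\<close> vertices. Let \<open>v\<close> have degree \<open>\<Delta>\<close>. For mutually orthogonal colorings,
  the color classes of \<open>v\<close> share no vertex but \<open>v\<close> and contain no neighbor of \<open>v\<close>. Hence \<open>k \<ge> 2\<close> such
  colorings give \<open>k (n - m - 1) + \<Delta> + 1 \<le> n^2 - m\<close>.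
\<close>

definition color_class :: "('a, 'b) pre_digraph \<Rightarrow> ('a \<Rightarrow> nat) \<Rightarrow> nat \<Rightarrow> 'a set" where
  "color_class G C c = {u \<in> verts G. C u = c}"

lemma card_color_class_le:
  assumes "orthogonal_colorings G C D" "D \<in> colorings G n"
  shows "card (color_class G C c) \<le> n"
proof -
  have "inj_on D (color_class G C c)"
    using assms(1) unfolding orthogonal_colorings_def color_class_def inj_on_def by fastforce
  moreover have "D ` color_class G C c \<subseteq> {..<n}"
    using assms(2) by (auto simp: colorings_def color_class_def)
  ultimately show ?thesis
    using card_inj_on_le[of D "color_class G C c" "{..<n}"] by simp
qed

text \<open>The additive form avoids truncated subtraction: \<open>(n - 1) * n\<close> is the most
  that the classes other than \<open>c\<close> can hold together.\<close>

lemma card_color_class_ge: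
  assumes "graph G" "C \<in> colorings G n" "D \<in> colorings G n" "orthogonal_colorings G C D"
    and "c < n"
  shows "card (verts G) \<le> card (color_class G C c) + (n - 1) * n"
proof -
  interpret graph G by fact
  let ?K = "color_class G C"
  have "verts G = (\<Union>i<n. ?K i)"
    using assms(2) by (auto simp: colorings_def color_class_def)
  also have "card \<dots> \<le> (\<Sum>i<n. card (?K i))"
    by (rule card_UN_le) simp
  also have "\<dots> = card (?K c) + (\<Sum>i\<in>{..<n} - {c}. card (?K i))"
    using \<open>c < n\<close> by (simp add: sum.remove)
  also have "(\<Sum>i\<in>{..<n} - {c}. card (?K i)) \<le> card ({..<n} - {c}) * n"
    using sum_bounded_above[of "{..<n} - {c}" "\<lambda>i. card (?K i)" n]
      card_color_class_le[OF assms(4,3)] by simp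
  finally show ?thesis
    using \<open>c < n\<close> by simp
qed

text \<open>Here \<open>d\<close> bounds from below the number of vertices other than
  \<open>v\<close> in the class of \<open>v\<close> under each coloring; the \<open>+ 1\<close> in
  \<open>d\<close> accounts for \<open>v\<close> itself. The theorem applies this with
  \<open>d = n - m - 1\<close>.\<close>

lemma mutually_orthogonal_degree_bound:
  assumes "graph G" "mutually_orthogonal G n S" "2 \<le> card S" "v \<in> verts G"
    and d: "d + (n - 1) * n + 1 \<le> card (verts G)"
  shows "card S * d + out_degree G v + 1 \<le> card (verts G)"
proof -
  interpret graph G by fact
  have S: "S \<subseteq> colorings G n" "pairwise (orthogonal_colorings G) S"
    using assms(2) by (auto simp: mutually_orthogonal_def)
  have "finite S"
    using assms(3) card.infinite[of S] by linarith
  \<comment> \<open>The sets \<open>B C\<close> for \<open>C\<close> in \<open>S\<close> and the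
    neighborhood \<open>N\<close> turn out to be pairwise disjoint subsets of
    \<open>verts G - {v}\<close>, so their sizes add up to at most
    \<open>card (verts G) - 1\<close>.\<close>
  define B where "B C = color_class G C (C v) - {v}" for C
  define N where "N = head G ` out_arcs G v"
  have B_sub: "B C \<subseteq> verts G - {v}" for C
    by (auto simp: B_def color_class_def)
  then have fin_B: "finite (B C)" for C
    using finite_verts finite_subset by blast
  have B_ge: "d \<le> card (B C)" if "C \<in> S" for C
  proof -
    \<comment> \<open>This is where \<open>2 \<le> card S\<close> enters: the lower bound on a color
      class of \<open>C\<close> requires a mate.\<close>
    obtain D where D: "D \<in> S" "D \<noteq> C"
      using assms(3) \<open>finite S\<close> that by (metis card_le_Suc0_iff_eq not_less_eq_eq numeral_2_eq_2)
    have "C v < n"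
      using S(1) that assms(4) by (auto simp: colorings_def)
    then have "card (verts G) \<le> card (color_class G C (C v)) + (n - 1) * n"
      using card_color_class_ge[OF assms(1)] S that D by (metis pairwiseD subsetD)
    moreover have "card (B C) = card (color_class G C (C v)) - 1"
      unfolding B_def using assms(4) by (simp add: color_class_def)
    ultimately show ?thesis
      using d by linarith
  qed
  have disjoint: "B C \<inter> B D = {}" if "C \<in> S" "D \<in> S" "C \<noteq> D" for C D
  proof -
    have "orthogonal_colorings G C D"
      using S(2) that by (simp add: pairwiseD)
    \<comment> \<open>A common element would be a vertex other than \<open>v\<close> that agrees
      with \<open>v\<close> under both colorings.\<close>
    then show ?thesis
      using assms(4) unfolding orthogonal_colorings_def B_def color_class_def by fastforce
  qed
  have N_sub: "N \<subseteq> verts G - {v}"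
    using no_loops by (auto simp: N_def)
  have "C u \<noteq> C v" if "C \<in> S" "u \<in> N" for C u
  proof -
    have "v \<rightarrow>\<^bsub>G\<^esub> u"
      using \<open>u \<in> N\<close> by (auto simp: N_def arcs_ends_def arc_to_ends_def)
    then show ?thesis
      using S(1) \<open>C \<in> S\<close> by (fastforce simp: colorings_def)
  qed
  then have B_N: "(\<Union>C\<in>S. B C) \<inter> N = {}"
    by (auto simp: B_def color_class_def)
  \<comment> \<open>Without parallel arcs, each neighbor is the head of exactly one arc out of
    \<open>v\<close>.\<close>
  have "inj_on (head G) (out_arcs G v)"
    using no_multi_arcs by (auto simp: inj_on_def arc_to_ends_def)
  then have card_N: "card N = out_degree G v"
    by (simp add: N_def out_degree_def card_image)
  have "card S * d \<le> (\<Sum>C\<in>S. card (B C))"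
    using sum_bounded_below[of S d "\<lambda>C. card (B C)"] B_ge by simp
  also have "\<dots> = card (\<Union>C\<in>S. B C)"
    using \<open>finite S\<close> fin_B disjoint by (simp add: card_UN_disjoint)
  finally have "card S * d + out_degree G v \<le> card (\<Union>C\<in>S. B C) + card N"
    using card_N by simp
  also have "\<dots> = card ((\<Union>C\<in>S. B C) \<union> N)"
    using \<open>finite S\<close> fin_B B_N finite_subset[OF N_sub] by (simp add: card_Un_disjoint)
  also have "\<dots> \<le> card (verts G - {v})"
    using B_sub N_sub by (intro card_mono) auto
  finally show ?thesis
    using card_Suc_Diff1[OF finite_verts assms(4)] by simp
qed

theorem theorem1p1:
  fixes G :: "('a, 'b) pre_digraph" and n m \<Delta> :: nat
  assumes "m < n - 1"
    and "graph G"
    and "card (verts G) = n^2 - m"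
    and "\<Delta> = max_degree G"
  shows "(\<Delta> \<ge> n^2 - n \<longrightarrow> max_orthogonal G n \<le> 1) \<and>
    (\<not> \<Delta> \<ge> n^2 - n \<longrightarrow>
      int (max_orthogonal G n) \<le>
        \<lfloor>(real n ^ 2 - real m - real \<Delta> - 1) / (real n - real m - 1)\<rfloor>)"
proof -
  interpret graph G by fact
  \<comment> \<open>The denominator of the bound, positive since \<open>m < n - 1\<close>. In terms
    of \<open>d\<close> the order of the graph is \<open>d + (n - 1) * n + 1\<close>, free of the
    subtraction of \<open>m\<close>.\<close>
  define d where "d = n - m - 1"
  have n: "n = d + m + 1" and "0 < d"
    using assms(1) by (auto simp: d_def)
  have sq: "n\<^sup>2 = (n - 1) * n + n"
    using n by (simp add: power2_eq_square)
  have card: "card (verts G) = d + (n - 1) * n + 1"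
    using assms(3) sq n by linarith
  then have "verts G \<noteq> {}"
    by auto
  then have "\<Delta> \<in> out_degree G ` verts G"
    unfolding assms(4) max_degree_def by (intro Max_in) auto
  then obtain v where v: "v \<in> verts G" "out_degree G v = \<Delta>"
    by auto
  have bound: "card S \<le> 1 \<or> card S * d + \<Delta> \<le> d + (n - 1) * n" if "mutually_orthogonal G n S" for S
    using mutually_orthogonal_degree_bound[OF assms(2) that _ v(1), of d] v(2) card by fastforce
  show ?thesis
  proof (intro conjI impI)
    assume "n\<^sup>2 - n \<le> \<Delta>"
    have "card S \<le> 1" if "mutually_orthogonal G n S" for S
    proof -
      \<comment> \<open>Since \<open>\<Delta>\<close> is at least \<open>(n - 1) * n\<close>, it
        absorbs that term in \<open>bound\<close>.\<close>
      have "card S \<le> 1 \<or> card S * d \<le> 1 * d"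
        using bound[OF that] sq \<open>n\<^sup>2 - n \<le> \<Delta>\<close> by linarith
      then show ?thesis
        using \<open>0 < d\<close> by simp
    qed
    then show "max_orthogonal G n \<le> 1"
      using max_orthogonal_le_iff[OF assms(2)] by blast
  next
    assume less: "\<not> n\<^sup>2 - n \<le> \<Delta>"
    \<comment> \<open>As \<open>\<Delta> < n^2 - n\<close>, the natural subtraction on the right
      does not truncate.\<close>
    have num: "real n ^ 2 - real m - real \<Delta> - 1 = real (d + (n - 1) * n - \<Delta>)"
    proof -
      have "real n ^ 2 = real ((n - 1) * n + n)"
        by (metis of_nat_power sq)
      then show ?thesis
        using less sq n by (simp add: of_nat_diff)
    qed
    have "card S \<le> (d + (n - 1) * n - \<Delta>) div d" if "mutually_orthogonal G n S" for S
    proof -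
      \<comment> \<open>The numerator is thus at least \<open>d\<close> and the quotient at least 1,
        which covers sets of at most one coloring, to which the degree bound does not apply.\<close>
      have "d + \<Delta> \<le> d + (n - 1) * n"
        using less sq by linarith
      moreover have "card S * d \<le> d" if "card S \<le> 1"
        using mult_le_mono1[OF that, of d] by simp
      ultimately have "card S * d \<le> d + (n - 1) * n - \<Delta>"
        using bound[OF that] by linarith
      then show ?thesis
        using \<open>0 < d\<close> by (simp add: less_eq_div_iff_mult_less_eq)
    qed
    then have "max_orthogonal G n \<le> (d + (n - 1) * n - \<Delta>) div d"
      using max_orthogonal_le_iff[OF assms(2)] by blast
    moreover have "real n - real m - 1 = real d"
      using n by simp
    ultimately show "int (max_orthogonal G n) \<le>
        \<lfloor>(real n ^ 2 - real m - real \<Delta> - 1) / (real n - real m - 1)\<rfloor>"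
      \<comment> \<open>The floor of a real quotient of naturals is their
        \<open>div\<close>.\<close>
      unfolding num by (simp only: floor_divide_of_nat_eq of_nat_le_iff)
  qed
qed

end
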